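(* Let $H_1$ and $H_2$ be shift-invariant graph reproducing kernel Hilbert spaces (SIGRKHSs), and let $T$ be a shift-invariant linear operator from $H_1$ to $H_2$, represented by a shift-invariant filter. Then $T$ is isometric, i.e., $\|T\mathbf{x}\|_{H_2}=\|\mathbf{x}\|_{H_1}$ for all $\mathbf{x}\in H_1$, if and only if for every $1\le m\le M$ the operator $\mathbf{P}_mT\mathbf{P}_m: W_m\cap H_1\to W_m\cap H_2$ is isometric (with respect to the norms of $H_1$ and $H_2$).
   Context: Let $\mathcal{G}=(V,E,\mathbf{W})$ be a finite, simple, undirected graph with $N\ge 2$ vertices. A graph signal is a vector $\mathbf{x}=[x(v)]_{v\in V}\in\mathbb{R}^V$. A graph shift is a matrix $\mathbf{S}=[s(i,j)]_{i,j\in V}$ with $s(i,j)=0$ unless $i=j$ or $(i,j)\in E$. Standing assumption: $\mathbf{S}_1,\ldots,\mathbf{S}_d$ are graph shifts that are real-valued, symmetric and pairwise commuting. Choose an orthogonal matrix $\mathbf{U}=[\mathbf{u}_1,\ldots,\mathbf{u}_N]$ with $\mathbf{S}_l=\sum_{n=1}^N\lambda_l(n)\mathbf{u}_n\mathbf{u}_n^T$ for $1\le l\le d$, and set $\boldsymbol{\lambda}(n)=[\lambda_1(n),\ldots,\lambda_d(n)]^T\in\mathbb{R}^d$. Let $\boldsymbol{\gamma}(m)=[\gamma_1(m),\ldots,\gamma_d(m)]^T$, $1\le m\le M$, be the distinct elements of $\{\boldsymbol{\lambda}(n): 1\le n\le N\}$. Put $\mathbf{P}_m=\sum_{\boldsymbol{\lambda}(n)=\boldsymbol{\gamma}(m)}\mathbf{u}_n\mathbf{u}_n^T$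 (independent of the choice of $\mathbf{U}$) and $W_m=\mathbf{P}_m\mathbb{R}^V=\bigcap_{l=1}^d\ker(\mathbf{S}_l-\gamma_l(m)\mathbf{I})$. A graph reproducing kernel Hilbert space (GRKHS) is a Hilbert space $H$ of graph signals (a linear subspace of $\mathbb{R}^V$ with an inner product $\langle\cdot,\cdot\rangle_H$ and norm $\|\cdot\|_H$) such that for every $v\in V$ there is a constant $C_v>0$ with $|x(v)|\le C_v\|\mathbf{x}\|_H$ for all $\mathbf{x}\in H$. Its reproducing kernel is the matrix $\mathbf{K}=[K(v,v')]_{v,v'\in V}$ whose columns $K(\cdot,v)$ lie in $H$ and satisfy $x(v)=\langle\mathbf{x},K(\cdot,v)\rangle_H$ for all $\mathbf{x}\in H$, $v\in V$; one has $H=\{\mathbf{K}\mathbf{c}:\mathbf{c}\in\mathbb{R}^V\}$. An SIGRKHS is a GRKHS whose reproducing kernel satisfies $\mathbf{K}\mathbf{S}_l=\mathbf{S}_l\mathbf{K}$ for all $1\le l\le d$. A shift-invariant linear operator $T:H_1\to H_2$ is one given by a shift-invariant filter, i.e. by a matrix $T\in\mathbb{R}^{V\times V}$ with $T\mathbf{S}_l=\mathbf{S}_lT$ for all $1\le l\le d$ and $TH_1\subset H_2$. *)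

theory Defs
  imports "HOL-Analysis.Analysis"
begin

text \<open>The vertex set is the finite type \<open>'v\<close>, graph signals are vectors in \<open>real^'v\<close>, and
  the shifts are indexed by the finite type \<open>'d\<close>. The edge relation contains both
  orientations of every edge. Edge weights impose no condition on graph shifts and are omitted.\<close>

definition simple_graph :: "('v \<times> 'v) set \<Rightarrow> bool" where
  "simple_graph E \<longleftrightarrow> sym E \<and> irrefl E"

definition graph_shift :: "('v \<times> 'v) set \<Rightarrow> real^'v^'v \<Rightarrow> bool" where
  "graph_shift E A \<longleftrightarrow> (\<forall>i j. i \<noteq> j \<and> (i, j) \<notin> E \<longrightarrow> A $ i $ j = 0)"

definition shift_invariant :: "('d \<Rightarrow> real^'v^'v) \<Rightarrow> real^'v^'v \<Rightarrow> bool" where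
  "shift_invariant S A \<longleftrightarrow> (\<forall>l. A ** S l = S l ** A)"

definition outer :: "real^'v \<Rightarrow> real^'v \<Rightarrow> real^'v^'v" where
  "outer x y = (\<chi> i j. x $ i * y $ j)"

text \<open>The columns of \<open>U\<close> are the joint eigenvectors; they are indexed by \<open>'v\<close> itself, which has
  the required cardinality \<open>N\<close>. The vector \<open>lam n\<close> collects the eigenvalues of all the shifts
  for the \<open>n\<close>-th column.\<close>

definition joint_diagonalization ::
    "('d::finite \<Rightarrow> real^'v^'v) \<Rightarrow> real^'v^'v \<Rightarrow> ('v \<Rightarrow> real^'d) \<Rightarrow> bool" where
  "joint_diagonalization S U lam \<longleftrightarrow> orthogonal_matrix U \<and>
     (\<forall>l. S l = (\<Sum>n\<in>UNIV. (lam n $ l) *\<^sub>R outer (column n U) (column n U)))"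

definition spectral_proj ::
    "real^'v^'v \<Rightarrow> ('v \<Rightarrow> real^'d) \<Rightarrow> real^'d \<Rightarrow> real^'v^'v" where
  "spectral_proj U lam g = (\<Sum>n | lam n = g. outer (column n U) (column n U))"

definition spectral_space ::
    "real^'v^'v \<Rightarrow> ('v \<Rightarrow> real^'d) \<Rightarrow> real^'d \<Rightarrow> (real^'v) set" where
  "spectral_space U lam g = range (\<lambda>x. spectral_proj U lam g *v x)"

text \<open>A Hilbert space of signals is a pair \<open>(H, ip)\<close> of a subspace and an inner product on it.
  The values of \<open>ip\<close> outside \<open>H\<close> are irrelevant; in general \<open>ip\<close> is unrelated to the
  Euclidean inner product of \<open>real^'v\<close>.\<close>

definition ip_norm :: "('a \<Rightarrow> 'a \<Rightarrow> real) \<Rightarrow> 'a \<Rightarrow> real" where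
  "ip_norm ip x = sqrt (ip x x)"

definition inner_product_on :: "'a::real_vector set \<Rightarrow> ('a \<Rightarrow> 'a \<Rightarrow> real) \<Rightarrow> bool" where
  "inner_product_on H ip \<longleftrightarrow> subspace H \<and>
     (\<forall>x\<in>H. \<forall>y\<in>H. ip x y = ip y x) \<and>
     (\<forall>x\<in>H. \<forall>y\<in>H. \<forall>z\<in>H. ip (x + y) z = ip x z + ip y z) \<and>
     (\<forall>c. \<forall>x\<in>H. \<forall>y\<in>H. ip (c *\<^sub>R x) y = c * ip x y) \<and>
     (\<forall>x\<in>H. x \<noteq> 0 \<longrightarrow> ip x x > 0)"

definition hilbert_space_on :: "'a::real_vector set \<Rightarrow> ('a \<Rightarrow> 'a \<Rightarrow> real) \<Rightarrow> bool" where
  "hilbert_space_on H ip \<longleftrightarrow> inner_product_on H ip \<and>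
     (\<forall>X :: nat \<Rightarrow> 'a. (\<forall>n. X n \<in> H) \<and>
        (\<forall>e>0. \<exists>n0. \<forall>m\<ge>n0. \<forall>n\<ge>n0. ip_norm ip (X m - X n) < e) \<longrightarrow>
        (\<exists>x\<in>H. (\<lambda>n. ip_norm ip (X n - x)) \<longlonglongrightarrow> 0))"

definition grkhs :: "(real^'v) set \<Rightarrow> (real^'v \<Rightarrow> real^'v \<Rightarrow> real) \<Rightarrow> bool" where
  "grkhs H ip \<longleftrightarrow> hilbert_space_on H ip \<and>
     (\<forall>v. \<exists>C>0. \<forall>x\<in>H. \<bar>x $ v\<bar> \<le> C * ip_norm ip x)"

definition reproducing_kernel ::
    "(real^'v) set \<Rightarrow> (real^'v \<Rightarrow> real^'v \<Rightarrow> real) \<Rightarrow> real^'v^'v \<Rightarrow> bool" where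
  "reproducing_kernel H ip K \<longleftrightarrow>
     (\<forall>v. column v K \<in> H \<and> (\<forall>x\<in>H. x $ v = ip x (column v K)))"

text \<open>A GRKHS has exactly one reproducing kernel, so the existential quantifier below
  speaks about that kernel.\<close>

definition sigrkhs ::
    "('d \<Rightarrow> real^'v^'v) \<Rightarrow> (real^'v) set \<Rightarrow> (real^'v \<Rightarrow> real^'v \<Rightarrow> real) \<Rightarrow> bool" where
  "sigrkhs S H ip \<longleftrightarrow> grkhs H ip \<and>
     (\<exists>K. reproducing_kernel H ip K \<and> shift_invariant S K)"

definition isometric_on ::
    "'a set \<Rightarrow> ('a \<Rightarrow> 'a \<Rightarrow> real) \<Rightarrow> ('b \<Rightarrow> 'b \<Rightarrow> real) \<Rightarrow> ('a \<Rightarrow> 'b) \<Rightarrow> bool" where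
  "isometric_on A ip1 ip2 f \<longleftrightarrow> (\<forall>x\<in>A. ip_norm ip2 (f x) = ip_norm ip1 x)"

end

theory Submission
  imports Defs
begin

text \<open>The spectral projections commute with everything that commutes with the shifts, in
  particular with \<open>T\<close> and with the kernels. Since \<open>ip (K c) x\<close> is the Euclidean product
  \<open>c \<bullet> x\<close>, each of them maps a shift-invariant space \<open>H = range K\<close> into itself and is
  self-adjoint for \<open>ip\<close>. So \<open>H\<close> is the \<open>ip\<close>-orthogonal sum of its intersections with the
  spectral spaces, \<open>T\<close> respects this decomposition, and on each summand it agrees with its
  compression.\<close>

section \<open>Matrix sums and the functional calculus of an orthonormal eigenbasis\<close>

lemma matrix_mult_sum_left: "(\<Sum>i\<in>I. A i) ** B = (\<Sum>i\<in>I. A i ** (B :: real^'n::finite^'m::finite))"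
  by (induction I rule: infinite_finite_induct) 
    (simp_all add: vec_eq_iff matrix_matrix_mult_def sum.distrib distrib_right)

lemma matrix_mult_sum_right: "B ** (\<Sum>i\<in>I. A i) = (\<Sum>i\<in>I. (B :: real^'n::finite^'m::finite) ** A i)"
  by (induction I rule: infinite_finite_induct) (simp_all add: matrix_add_ldistrib)

lemma matrix_vector_mult_sum_left:
  "(\<Sum>i\<in>I. A i) *v x = (\<Sum>i\<in>I. A i *v (x :: real^'n::finite))"
  by (induction I rule: infinite_finite_induct) (simp_all add: matrix_vector_mult_add_rdistrib)

text \<open>This is \<open>U ** D ** transpose U\<close> with \<open>D\<close> diagonal with entries
  \<open>f n\<close>. Shifts and spectral projections both have this form, so their products reduce
  to pointwise products of functions.\<close>

definition spectral_sum :: "real^'v^'v \<Rightarrow> ('v::finite \<Rightarrow> real) \<Rightarrow> real^'v^'v" where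
  "spectral_sum U f = (\<Sum>n\<in>UNIV. f n *\<^sub>R outer (column n U) (column n U))"

lemma spectral_sum_nth:
  "spectral_sum U f $ i $ j = (\<Sum>n\<in>UNIV. f n * (U $ i $ n * U $ j $ n))"
  by (simp add: spectral_sum_def outer_def column_def)

text \<open>Once the sum over the matrix index \<open>k\<close> is innermost, orthonormality of the
  columns of \<open>U\<close> leaves only the terms with \<open>n = m\<close>.\<close>

lemma spectral_sum_mult:
  fixes U :: "real^'v::finite^'v"
  assumes "orthogonal_matrix U"
  shows "spectral_sum U f ** spectral_sum U g = spectral_sum U (\<lambda>n. f n * g n)"
proof -
  have UU: "(\<Sum>k\<in>UNIV. U $ k $ n * U $ k $ m) = (if n = m then 1 else 0)" for n m
  proof -
    have "(transpose U ** U) $ n $ m = (mat 1 :: real^'v^'v) $ n $ m"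
      using assms by (simp add: orthogonal_matrix_def)
    then show ?thesis
      by (simp add: matrix_matrix_mult_def transpose_def mat_def)
  qed
  have "(spectral_sum U f ** spectral_sum U g) $ i $ j = spectral_sum U (\<lambda>n. f n * g n) $ i $ j"
    for i j
  proof -
    have "(spectral_sum U f ** spectral_sum U g) $ i $ j =
      (\<Sum>k\<in>UNIV. \<Sum>n\<in>UNIV. \<Sum>m\<in>UNIV.
        (f n * (U $ i $ n * U $ k $ n)) * (g m * (U $ k $ m * U $ j $ m)))"
      by (simp add: matrix_matrix_mult_def spectral_sum_nth sum_product)
    also have "\<dots> = (\<Sum>n\<in>UNIV. \<Sum>k\<in>UNIV. \<Sum>m\<in>UNIV.
        (f n * (U $ i $ n * U $ k $ n)) * (g m * (U $ k $ m * U $ j $ m)))"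
      by (rule sum.swap)
    also have "\<dots> = (\<Sum>n\<in>UNIV. \<Sum>m\<in>UNIV. \<Sum>k\<in>UNIV.
        (f n * (U $ i $ n * U $ k $ n)) * (g m * (U $ k $ m * U $ j $ m)))"
      by (intro sum.cong refl sum.swap)
    also have "\<dots> = (\<Sum>n\<in>UNIV. \<Sum>m\<in>UNIV. f n * U $ i $ n * g m * U $ j $ m *
        (\<Sum>k\<in>UNIV. U $ k $ n * U $ k $ m))"
      by (simp add: sum_distrib_left mult_ac)
    also have "\<dots> = spectral_sum U (\<lambda>n. f n * g n) $ i $ j"
      by (simp add: UU spectral_sum_nth mult_ac if_distrib cong: if_cong)
    finally show ?thesis .
  qed
  then show ?thesis by (simp add: vec_eq_iff)
qed

lemma spectral_sum_one:
  fixes U :: "real^'v::finite^'v"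
  assumes "orthogonal_matrix U"
  shows "spectral_sum U (\<lambda>_. 1) = mat 1"
proof -
  have "spectral_sum U (\<lambda>_. 1) = U ** transpose U"
    by (simp add: vec_eq_iff spectral_sum_nth matrix_matrix_mult_def transpose_def)
  then show ?thesis using assms by (simp add: orthogonal_matrix_def)
qed

lemma spectral_sum_scale: "spectral_sum U (\<lambda>n. c * f n) = c *\<^sub>R spectral_sum U f"
  by (simp add: spectral_sum_def scaleR_sum_right)

lemma spectral_proj_eq_sum:
  "spectral_proj U lam g = spectral_sum U (\<lambda>n. if lam n = g then 1 else 0)"
  by (simp add: spectral_proj_def spectral_sum_def if_distrib[of "\<lambda>c. c *\<^sub>R _"] sum.If_cases)

lemma transpose_spectral_proj: "transpose (spectral_proj U lam g) = spectral_proj U lam g"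
  by (simp add: spectral_proj_eq_sum vec_eq_iff transpose_def spectral_sum_nth mult_ac)

lemma spectral_proj_mult:
  assumes "orthogonal_matrix U"
  shows "spectral_proj U lam g ** spectral_proj U lam h =
    (if g = h then spectral_proj U lam g else 0)"
proof (cases "g = h")
  case True
  then show ?thesis
    by (simp add: spectral_proj_eq_sum spectral_sum_mult[OF assms] if_distrib cong: if_cong)
next
  case False
  then have "(\<lambda>n. (if lam n = g then 1 else 0) * (if lam n = h then 1 else 0)) = (\<lambda>n. 0::real)"
    by auto
  with False show ?thesis
    by (simp add: spectral_proj_eq_sum spectral_sum_mult[OF assms])
      (simp add: spectral_sum_def)
qed

text \<open>Summing over the fibres of \<open>lam\<close> recovers the sum over all columns, which
  is the identity because the columns of \<open>U\<close> form an orthonormal basis.\<close>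

lemma sum_spectral_proj:
  assumes "orthogonal_matrix U"
  shows "(\<Sum>g\<in>range lam. spectral_proj U lam g) = mat 1"
proof -
  have "(\<Sum>g\<in>range lam. spectral_proj U lam g) = spectral_sum U (\<lambda>_. 1)"
    unfolding spectral_proj_def spectral_sum_def
    using sum.image_gen[of UNIV "\<lambda>n. outer (column n U) (column n U)" lam] by simp
  then show ?thesis using spectral_sum_one[OF assms] by simp
qed

lemma sum_spectral_proj_vec:
  assumes "orthogonal_matrix U"
  shows "(\<Sum>g\<in>range lam. spectral_proj U lam g *v x) = x"
  using arg_cong[OF sum_spectral_proj[OF assms, of lam], of "\<lambda>A. A *v x"]
  by (simp add: matrix_vector_mult_sum_left)

text \<open>With respect to the resolution of the identity by the projections, \<open>A\<close> is
  block diagonal: both products equal the diagonal block at \<open>g\<close>.\<close>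

lemma spectral_proj_commute:
  fixes S :: "'d::finite \<Rightarrow> real^'v::finite^'v"
  assumes diag: "joint_diagonalization S U lam"
    and A: "shift_invariant S A"
  shows "A ** spectral_proj U lam g = spectral_proj U lam g ** A"
proof -
  have U: "orthogonal_matrix U"
    using diag by (simp add: joint_diagonalization_def)
  have S: "S l = spectral_sum U (\<lambda>n. lam n $ l)" for l
    using diag by (simp add: joint_diagonalization_def spectral_sum_def)
  let ?P = "spectral_proj U lam"
  have SP: "S l ** ?P h = (h $ l) *\<^sub>R ?P h" and PS: "?P h ** S l = (h $ l) *\<^sub>R ?P h" for l h
  proof -
    have "(\<lambda>n. lam n $ l * (if lam n = h then 1 else 0)) = (\<lambda>n. h $ l * (if lam n = h then 1 else 0))"
      and "(\<lambda>n. (if lam n = h then 1 else 0) * lam n $ l) = (\<lambda>n. h $ l * (if lam n = h then 1 else 0))"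
      by auto
    then show "S l ** ?P h = (h $ l) *\<^sub>R ?P h" "?P h ** S l = (h $ l) *\<^sub>R ?P h"
      by (simp_all only: S spectral_proj_eq_sum spectral_sum_mult[OF U] spectral_sum_scale)
  qed
  have off: "?P h ** A ** ?P k = 0" if hk: "h \<noteq> k" for h k
  proof -
    \<comment> \<open>Distinct joint eigenvalues differ in some coordinate \<open>l\<close>.
      Absorbed on the left, \<open>S l\<close> scales the block by \<open>h $ l\<close>; moved
      through \<open>A\<close> and absorbed on the right, by \<open>k $ l\<close>.\<close>
    obtain l where l: "h $ l \<noteq> k $ l" using hk by (auto simp: vec_eq_iff)
    have "(h $ l) *\<^sub>R (?P h ** A ** ?P k) = ?P h ** (S l ** A) ** ?P k"
      by (simp add: PS scalar_matrix_assoc matrix_mul_assoc)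
    also have "\<dots> = ?P h ** A ** (S l ** ?P k)"
      using A by (metis shift_invariant_def matrix_mul_assoc)
    also have "\<dots> = (k $ l) *\<^sub>R (?P h ** A ** ?P k)"
      by (simp add: SP matrix_scalar_ac scalar_matrix_assoc)
    finally show ?thesis using l by simp
  qed
  show ?thesis
  proof (cases "g \<in> range lam")
    case True
    have "A ** ?P g = (\<Sum>h\<in>range lam. ?P h) ** (A ** ?P g)"
      by (simp add: sum_spectral_proj[OF U])
    also have "\<dots> = (\<Sum>h\<in>range lam. ?P h ** A ** ?P g)"
      by (simp add: matrix_mult_sum_left matrix_mul_assoc)
    also have "\<dots> = ?P g ** A ** ?P g"
      using True by (subst sum.remove[of _ g]) (auto intro!: sum.neutral off)
    also have "\<dots> = (\<Sum>h\<in>range lam. ?P g ** A ** ?P h)"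
      using True by (subst sum.remove[of _ g]) (auto intro!: sum.neutral off)
    also have "\<dots> = ?P g ** A ** (\<Sum>h\<in>range lam. ?P h)"
      by (simp add: matrix_mult_sum_right)
    also have "\<dots> = ?P g ** A"
      by (simp add: sum_spectral_proj[OF U])
    finally show ?thesis .
  next
    case False
    then have "{n. lam n = g} = {}" by auto
    then show ?thesis by (simp add: spectral_proj_def)
  qed
qed

section \<open>Inner product spaces of signals with a reproducing kernel\<close>

lemma inner_product_on_sum_left:
  assumes "inner_product_on H ip" "y \<in> H" "finite A" "\<And>i. i \<in> A \<Longrightarrow> f i \<in> H"
  shows "ip (sum f A) y = (\<Sum>i\<in>A. ip (f i) y)"
  using assms(3,4)
proof (induction A rule: finite_induct)
  case empty
  \<comment> \<open>Homogeneity with scalar 0 supplies the value of \<open>ip\<close> at the zero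
    vector.\<close>
  have "ip (0 *\<^sub>R y) y = 0 * ip y y"
    using assms(1,2) by (simp only: inner_product_on_def)
  then show ?case by simp
next
  case (insert i A)
  have "sum f A \<in> H"
    using assms(1) insert.prems by (auto simp: inner_product_on_def intro: subspace_sum)
  then have "ip (f i + sum f A) y = ip (f i) y + ip (sum f A) y"
    using assms(1,2) insert.prems by (simp add: inner_product_on_def)
  then show ?case using insert by simp
qed

locale kernel_space =
  fixes H :: "(real^'v::finite) set" and ip :: "real^'v \<Rightarrow> real^'v \<Rightarrow> real" and K :: "real^'v^'v"
  assumes inner: "inner_product_on H ip" and kernel: "reproducing_kernel H ip K"
begin

lemma subspace_space: "subspace H"
  using inner by (simp add: inner_product_on_def)

lemma ip_commute: "x \<in> H \<Longrightarrow> y \<in> H \<Longrightarrow> ip x y = ip y x"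
  using inner by (simp add: inner_product_on_def)

lemma ip_scale: "x \<in> H \<Longrightarrow> y \<in> H \<Longrightarrow> ip (c *\<^sub>R x) y = c * ip x y"
  using inner by (simp add: inner_product_on_def)

lemma column_mem: "column v K \<in> H"
  using kernel by (simp add: reproducing_kernel_def)

lemma reproducing: "x \<in> H \<Longrightarrow> ip x (column v K) = x $ v"
  using kernel by (simp add: reproducing_kernel_def)

lemma kernel_mult_eq: "K *v c = (\<Sum>v\<in>UNIV. c $ v *\<^sub>R column v K)"
  by (simp add: matrix_mult_sum scalar_mult_eq_scaleR)

lemma kernel_mult_mem: "K *v c \<in> H"
  unfolding kernel_mult_eq
  by (intro subspace_sum subspace_scale subspace_space column_mem)

text \<open>Expanding \<open>K *v c\<close> in the columns of \<open>K\<close> and using the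
  reproducing property on each turns \<open>ip\<close> into the Euclidean product, where matrices
  can be moved across by transposition.\<close>

lemma ip_kernel_mult:
  assumes "x \<in> H"
  shows "ip (K *v c) x = c \<bullet> x"
proof -
  have "ip (K *v c) x = (\<Sum>v\<in>UNIV. ip (c $ v *\<^sub>R column v K) x)"
    unfolding kernel_mult_eq
    by (intro inner_product_on_sum_left[OF inner assms])
      (auto intro: subspace_scale subspace_space column_mem)
  also have "\<dots> = (\<Sum>v\<in>UNIV. c $ v * x $ v)"
    by (simp add: ip_scale column_mem assms ip_commute[OF column_mem assms] reproducing)
  finally show ?thesis by (simp add: inner_vec_def)
qed

text \<open>Each \<open>x\<close> in \<open>H\<close> differs from a member of \<open>range K\<close> by some \<open>z\<close> in \<open>H\<close> that is Euclidean
  orthogonal to \<open>range K\<close>. As \<open>K\<close> is symmetric, \<open>K z = 0\<close>, so \<open>0 = ip (K z) z = z \<bullet> z\<close>.\<close>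

lemma space_eq_range: "H = range ((*v) K)"
proof
  show "range ((*v) K) \<subseteq> H" using kernel_mult_mem by auto
  \<comment> \<open>By the reproducing property, each entry of \<open>K\<close> is the
    \<open>ip\<close> product of two columns, so symmetry of \<open>ip\<close> passes to
    \<open>K\<close>.\<close>
  have sym: "transpose K = K"
  proof -
    have "K $ w $ v = K $ v $ w" for v w
      using reproducing[OF column_mem, of v w] reproducing[OF column_mem, of w v]
        ip_commute[OF column_mem column_mem, of v w] by (simp add: column_def)
    then show ?thesis by (simp add: vec_eq_iff transpose_def)
  qed
  show "H \<subseteq> range ((*v) K)"
  proof
    fix x assume x: "x \<in> H"
    have sub: "subspace (range ((*v) K))"
      by (simp add: linear_subspace_image)
    obtain y z where y: "y \<in> span (range ((*v) K))"
      and z: "\<And>w. w \<in> span (range ((*v) K)) \<Longrightarrow> orthogonal z w" and xyz: "x = y + z"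
      using orthogonal_subspace_decomp_exists[of "range ((*v) K)" x] by blast
    have yr: "y \<in> range ((*v) K)" using y span_eq_iff[THEN iffD2, OF sub] by blast
    then have "y \<in> H" using kernel_mult_mem by auto
    then have zH: "z \<in> H" using x xyz subspace_diff[OF subspace_space x, of y] by simp
    have "z \<bullet> (K *v (K *v z)) = 0"
      using z[of "K *v (K *v z)"] by (simp add: orthogonal_def span_base)
    then have "(K *v z) \<bullet> (K *v z) = 0"
      by (metis dot_lmul_matrix transpose_matrix_vector sym)
    \<comment> \<open>Writing zero as \<open>K *v 0\<close> lets \<open>ip_kernel_mult\<close>
      evaluate both sides of the comparison that follows.\<close>
    then have "K *v z = K *v 0" by simp
    then have "z \<bullet> z = 0 \<bullet> z" using ip_kernel_mult[OF zH] by metis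
    then show "x \<in> range ((*v) K)" using xyz yr by simp
  qed
qed

context
  fixes P :: "real^'v^'v"
  assumes commute: "K ** P = P ** K"
begin

text \<open>\<open>P\<close> sends \<open>K *v c\<close> to \<open>K *v (P *v c)\<close>, which is
  again in the range of \<open>K\<close>.\<close>

lemma commuting_mem: "x \<in> H \<Longrightarrow> P *v x \<in> H"
  unfolding space_eq_range
  by (metis (no_types, lifting) commute imageE matrix_vector_mul_assoc rangeI)

text \<open>For \<open>x = K *v c\<close>, both sides equal the Euclidean product of
  \<open>c\<close> with \<open>P *v y\<close>.\<close>

lemma commuting_self_adjoint:
  assumes "transpose P = P" "x \<in> H" "y \<in> H"
  shows "ip (P *v x) y = ip x (P *v y)"
proof -
  obtain c where c: "x = K *v c" using \<open>x \<in> H\<close> unfolding space_eq_range by auto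
  have "ip (P *v x) y = ip (K *v (P *v c)) y"
    by (simp add: c matrix_vector_mul_assoc commute)
  also have "\<dots> = c \<bullet> (P *v y)"
    using assms by (metis ip_kernel_mult dot_lmul_matrix transpose_matrix_vector)
  also have "\<dots> = ip x (P *v y)"
    using ip_kernel_mult[OF commuting_mem[OF \<open>y \<in> H\<close>]] c by simp
  finally show ?thesis .
qed

end

end

section \<open>Orthogonal decomposition of an SIGRKHS along the spectral spaces\<close>

lemma sigrkhs_spectral_proj_mem:
  assumes "joint_diagonalization S U lam" "sigrkhs S H ip" "x \<in> H"
  shows "spectral_proj U lam g *v x \<in> H"
proof -
  obtain K where "kernel_space H ip K" "shift_invariant S K"
    using assms(2) by (auto simp: sigrkhs_def grkhs_def hilbert_space_on_def kernel_space_def)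
  then show ?thesis
    using kernel_space.commuting_mem spectral_proj_commute assms(1,3) by blast
qed

text \<open>Only the first argument is decomposed. Idempotence then splits off a second projection,
  which self-adjointness moves to the other argument, so no cross terms arise.\<close>

lemma sigrkhs_pythagoras:
  assumes "joint_diagonalization S U lam" "sigrkhs S H ip" "x \<in> H"
  shows "ip x x = (\<Sum>g\<in>range lam. ip (spectral_proj U lam g *v x) (spectral_proj U lam g *v x))"
proof -
  obtain K where K: "kernel_space H ip K" "shift_invariant S K"
    using assms(2) by (auto simp: sigrkhs_def grkhs_def hilbert_space_on_def kernel_space_def)
  have U: "orthogonal_matrix U"
    using assms(1) by (simp add: joint_diagonalization_def)
  let ?P = "spectral_proj U lam"
  have mem: "?P g *v x \<in> H" for g
    using sigrkhs_spectral_proj_mem[OF assms] .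
  have "ip x x = ip (\<Sum>g\<in>range lam. ?P g *v x) x"
    by (simp add: sum_spectral_proj_vec[OF U])
  also have "\<dots> = (\<Sum>g\<in>range lam. ip (?P g *v x) x)"
    using kernel_space.inner[OF K(1)] assms(3) mem by (intro inner_product_on_sum_left) auto
  also have "\<dots> = (\<Sum>g\<in>range lam. ip (?P g *v (?P g *v x)) x)"
    by (simp add: matrix_vector_mul_assoc spectral_proj_mult[OF U])
  also have "\<dots> = (\<Sum>g\<in>range lam. ip (?P g *v x) (?P g *v x))"
    using kernel_space.commuting_self_adjoint[OF K(1) spectral_proj_commute[OF assms(1) K(2)]
      transpose_spectral_proj mem assms(3)] by simp
  finally show ?thesis .
qed

section \<open>Isometry on the whole space and on its spectral pieces\<close>

theorem theorem5p6:
  fixes E :: "('v::finite \<times> 'v) set"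
    and S :: "'d::finite \<Rightarrow> real^'v^'v"
    and U :: "real^'v^'v"
    and lam :: "'v \<Rightarrow> real^'d"
    and M :: nat
    and gam :: "nat \<Rightarrow> real^'d"
    and H1 H2 :: "(real^'v) set"
    and ip1 ip2 :: "real^'v \<Rightarrow> real^'v \<Rightarrow> real"
    and T :: "real^'v^'v"
  defines "P \<equiv> \<lambda>m. spectral_proj U lam (gam m)"
    and "W \<equiv> \<lambda>m. spectral_space U lam (gam m)"
  assumes "CARD('v) \<ge> 2"
    and "simple_graph E"
    and "\<And>l. graph_shift E (S l)"
    and "\<And>l. transpose (S l) = S l"
    and "\<And>k l. S k ** S l = S l ** S k"
    and "joint_diagonalization S U lam"
    and "bij_betw gam {1..M} (range lam)"
    and "sigrkhs S H1 ip1"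
    and "sigrkhs S H2 ip2"
    and "shift_invariant S T"
    and "\<And>x. x \<in> H1 \<Longrightarrow> T *v x \<in> H2"
  shows "(\<forall>m\<in>{1..M}. \<forall>x\<in>W m \<inter> H1. (P m ** T ** P m) *v x \<in> W m \<inter> H2) \<and>
    (isometric_on H1 ip1 ip2 (\<lambda>x. T *v x) \<longleftrightarrow>
     (\<forall>m\<in>{1..M}. isometric_on (W m \<inter> H1) ip1 ip2 (\<lambda>x. (P m ** T ** P m) *v x)))"
proof -
  note diag = \<open>joint_diagonalization S U lam\<close>
  let ?P = "spectral_proj U lam"
  have U: "orthogonal_matrix U"
    using diag by (simp add: joint_diagonalization_def)
  have TP: "T *v (?P g *v x) = ?P g *v (T *v x)" for g x
    using spectral_proj_commute[OF diag \<open>shift_invariant S T\<close>]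
    by (simp add: matrix_vector_mul_assoc)
  have PP: "?P g *v (?P g *v x) = ?P g *v x" for g x
    by (simp add: matrix_vector_mul_assoc spectral_proj_mult[OF U])
  \<comment> \<open>The range of an idempotent is its set of fixed points, a form suited to
    rewriting.\<close>
  have W: "x \<in> W m \<longleftrightarrow> P m *v x = x" for x m
  proof
    assume "x \<in> W m"
    then obtain z where "x = P m *v z" unfolding W_def P_def spectral_space_def by auto
    then show "P m *v x = x" unfolding P_def using PP by simp
  next
    assume "P m *v x = x"
    then show "x \<in> W m" unfolding W_def P_def spectral_space_def by (metis rangeI)
  qed
  have PT: "P m *v (T *v x) = T *v x" if "x \<in> W m" for m x
    using that unfolding W P_def by (metis TP)
  have PTP: "(P m ** T ** P m) *v x = T *v x" if "x \<in> W m" for m x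
    using that PT[OF that] unfolding W by (metis matrix_vector_mul_assoc)
  have "(P m ** T ** P m) *v x \<in> W m \<inter> H2" if "x \<in> W m \<inter> H1" for m x
    using that assms(13) PTP[of x m] PT[of x m] by (auto simp: W)
  moreover have "isometric_on H1 ip1 ip2 (\<lambda>x. T *v x)"
    if iso: "\<And>m. m \<in> {1..M} \<Longrightarrow> isometric_on (W m \<inter> H1) ip1 ip2 (\<lambda>x. (P m ** T ** P m) *v x)"
    unfolding isometric_on_def
  proof
    fix x assume x: "x \<in> H1"
    have "ip2 (?P g *v (T *v x)) (?P g *v (T *v x)) = ip1 (?P g *v x) (?P g *v x)"
      if g: "g \<in> range lam" for g
    proof -
      \<comment> \<open>\<open>gam\<close> enumerates \<open>range lam\<close>, so the assumed
        isometry for some \<open>m\<close> applies to the component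
        \<open>?P g *v x\<close>.\<close>
      obtain m where m: "m \<in> {1..M}" "g = gam m"
        using \<open>bij_betw gam {1..M} (range lam)\<close> g by (metis bij_betw_def imageE)
      have "?P g *v x \<in> W m \<inter> H1"
        using sigrkhs_spectral_proj_mem[OF diag \<open>sigrkhs S H1 ip1\<close> x] PP by (simp add: W P_def m)
      then have "ip_norm ip2 (T *v (?P g *v x)) = ip_norm ip1 (?P g *v x)"
        using iso[OF m(1)] PTP by (auto simp: isometric_on_def)
      then show ?thesis by (simp add: ip_norm_def TP)
    qed
    \<comment> \<open>The decompositions of \<open>x\<close> in \<open>H1\<close> and of
      \<open>T *v x\<close> in \<open>H2\<close> run over the same index set
      \<open>range lam\<close> and agree term by term.\<close>
    then have "ip2 (T *v x) (T *v x) = ip1 x x"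
      using sigrkhs_pythagoras[OF diag \<open>sigrkhs S H1 ip1\<close> x]
        sigrkhs_pythagoras[OF diag \<open>sigrkhs S H2 ip2\<close> assms(13)[OF x]] by simp
    then show "ip_norm ip2 (T *v x) = ip_norm ip1 x" by (simp add: ip_norm_def)
  qed
  \<comment> \<open>The remaining forward implication restricts the isometry to
    \<open>W m \<inter> H1\<close>, where \<open>PTP\<close> replaces \<open>T\<close> by its
    compression.\<close>
  ultimately show ?thesis using PTP by (auto simp: isometric_on_def)
qed

end
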